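(* Let $0<\alpha<2$, $\lambda\in\mathbb{R}$, $\Sigma=\{x\in\mathbb{R}^n : x_1<\lambda\}$, and let $x^\lambda=(2\lambda-x_1,x_2,\dots,x_n)$ denote the reflection of $x$ about the plane $\{x_1=\lambda\}$. Let $\Omega$ be an unbounded region in $\Sigma$ and let $c:\Omega\to\mathbb{R}$ satisfy $$\liminf_{|x|\to\infty}|x|^{\alpha}c(x)\ge 0 .$$ Then there exists a constant $R_0>0$ (depending on $c$, but independent of $w$) such that the following holds. If $w\in L_\alpha\cap C^{1,1}_{loc}(\Omega)$ satisfies $$ \begin{cases} (-\Delta)^{\alpha/2}w(x)+c(x)w(x)\ge 0 & \text{for } x\in\Omega,\\ w(x)\ge 0 & \text{for } x\in\Sigma\setminus\Omega,\\ w(x^\lambda)=-w(x) & \text{for } x\in\Sigma, \end{cases} $$ and if $x^0\in\Omega$ is a point with $$w(x^0)=\min_{\Omega}w<0,$$ then $|x^0|\le R_0$.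
   Context: $L_\alpha=\{u:\mathbb{R}^n\to\mathbb{R} : \int_{\mathbb{R}^n}\frac{|u(x)|}{1+|x|^{n+\alpha}}\,dx<\infty\}$. $C^{1,1}_{loc}(\Omega)$ denotes functions that are (on $\Omega$) differentiable with locally Lipschitz gradient. For $0<\alpha<2$, $u\in L_\alpha$ and $x$ in an open set where $u$ is $C^{1,1}_{loc}$, the fractional Laplacian is defined pointwise by $$(-\Delta)^{\alpha/2}u(x)=C_{n,\alpha}\lim_{\epsilon\to0}\int_{\mathbb{R}^n\setminus B_\epsilon(x)}\frac{u(x)-u(z)}{|x-z|^{n+\alpha}}\,dz,$$ where $C_{n,\alpha}>0$ is a normalization constant. The limit inferior of $|x|^\alpha c(x)$ is taken over $x\in\Omega$, where $c$ is defined. *)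

theory Defs
  imports "HOL-Analysis.Analysis"
begin

text \<open>
  The coordinate in whose direction one reflects (the first one in the usual notation) is an
  index \<open>k\<close> of the finite index type. The Lebesgue sigma-algebra is used, so that
  ``measurable'' below means Lebesgue measurable.
\<close>

definition halfspace :: "'n::finite \<Rightarrow> real \<Rightarrow> (real ^ 'n) set" where
  "halfspace k l = {x. x $ k < l}"

definition reflect :: "'n::finite \<Rightarrow> real \<Rightarrow> real ^ 'n \<Rightarrow> real ^ 'n" where
  "reflect k l x = (\<chi> i. if i = k then 2 * l - x $ k else x $ i)"

definition L_space :: "real \<Rightarrow> (real ^ 'n::finite \<Rightarrow> real) set" where
  "L_space \<alpha> = {u. u \<in> borel_measurable lebesgue \<and>
     (\<integral>\<^sup>+ x. ennreal (\<bar>u x\<bar> / (1 + norm x powr (real CARD('n) + \<alpha>))) \<partial>lebesgue) < \<infinity>}"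

definition C11_loc :: "(real ^ 'n::finite) set \<Rightarrow> (real ^ 'n \<Rightarrow> real) set" where
  "C11_loc \<Omega> = {u. \<exists>g. (\<forall>x\<in>\<Omega>. GDERIV u x :> g x) \<and>
     (\<forall>x\<in>\<Omega>. \<exists>r>0. \<exists>K. K-lipschitz_on (ball x r \<inter> \<Omega>) g)}"

text \<open>
  The normalization constant is the parameter \<open>C\<close>. The value is unspecified if the
  limit does not exist; it does exist when \<open>0 < \<alpha> < 2\<close>, \<open>u \<in> L_space \<alpha>\<close> and \<open>x\<close> lies in an open
  set \<open>\<Omega>\<close> with \<open>u \<in> C11_loc \<Omega>\<close>.
\<close>

definition frac_laplacian ::
  "real \<Rightarrow> real \<Rightarrow> (real ^ 'n::finite \<Rightarrow> real) \<Rightarrow> real ^ 'n \<Rightarrow> real" where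
  "frac_laplacian C \<alpha> u x = C * Lim (at_right 0) (\<lambda>\<epsilon>.
     LINT z : (UNIV - ball x \<epsilon>) | lebesgue.
       (u x - u z) / norm (x - z) powr (real CARD('n) + \<alpha>))"

end

theory Submission
  imports Defs
begin

text \<open>
  A negative minimum over the region is a minimum over the whole half-space. Since the gradient
  vanishes there and is locally Lipschitz, the quotient in the fractional Laplacian is absolutely
  integrable, so the principal value is a Lebesgue integral. Pairing a point \<open>y\<close> of the half-space with
  its mirror image, which is farther from \<open>x\<^sub>0\<close>, bounds the two contributions together by
  \<open>2 w(x\<^sub>0) |x\<^sub>0 - y\<^sup>l| powr -(n + \<alpha>)\<close>. On a ball of radius \<open>r = |x\<^sub>0| + |l|\<close> in the half-space
  the distance is at most \<open>8 r\<close>, so the fractional Laplacian at \<open>x\<^sub>0\<close> is at most a positive constant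
  times \<open>w(x\<^sub>0) r powr -\<alpha>\<close>. The differential inequality then makes
  \<open>|x\<^sub>0| powr \<alpha> * c(x\<^sub>0)\<close> smaller than a fixed negative constant, which the limit inferior excludes far out.
\<close>

section \<open>Integrability of powers of the distance near a point and near infinity\<close>

lemma power_of_two_bracket:
  fixes t :: real assumes "1 \<le> t"
  obtains j :: nat where "2 ^ j \<le> t" "t \<le> 2 * 2 ^ j"
proof -
  define m where "m = (LEAST m. t < 2 ^ m)"
  obtain m0 :: nat where "t < 2 ^ m0" using real_arch_pow[of 2 t] by auto
  hence m: "t < 2 ^ m" unfolding m_def by (rule LeastI)
  with assms have "m \<noteq> 0" by (intro notI) auto
  then obtain j where j: "m = Suc j" using not0_implies_Suc by blast
  have "\<not> t < 2 ^ j" using not_less_Least[of j "\<lambda>m. t < 2 ^ m"] j unfolding m_def[symmetric] by simp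
  with m j show ?thesis by (intro that[of j]) auto
qed

text \<open>On a shell with radii between \<rho> and 2\<rho> the integrand is comparable to
  \<open>\<rho> powr p\<close>, and the volume is at most a multiple of
  \<open>\<rho> ^ DIM('a)\<close>. For \<rho> = s q^j the contributions are bounded by a geometric
  series of ratio \<open>q powr (p + DIM('a))\<close>. Leaving \<open>q\<close> open serves shells
  that shrink to \<open>a\<close> (\<open>q = 1 / 2\<close>) and shells that grow to infinity
  (\<open>q = 2\<close>).\<close>

lemma set_integrable_norm_powr_shells:
  fixes a :: "'a::euclidean_space" and p q s :: real
  assumes q: "0 < q" "q powr (p + DIM('a)) < 1" and s: "0 < s" and S: "S \<in> sets borel"
    and cover: "\<And>x. x \<in> S \<Longrightarrow> x \<noteq> a \<Longrightarrow> \<exists>j::nat. s * q ^ j \<le> norm (x - a) \<and> norm (x - a) \<le> 2 * (s * q ^ j)"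
  shows "set_integrable lebesgue S (\<lambda>x. norm (x - a) powr p)"
proof -
  \<comment> \<open>Between \<rho> and 2\<rho> the power is largest at 2\<rho> if p \<ge> 0 and at
    \<rho> otherwise; the maximum covers both signs.\<close>
  define A where "A = max 1 (2 powr p)"
  define V where "V = unit_ball_vol (real DIM('a))"
  let ?r = "\<lambda>j::nat. s * q ^ j"
  \<comment> \<open>A full ball stands in for each shell: its volume is known, and only a constant
    factor is lost.\<close>
  let ?h = "\<lambda>j x. ennreal (A * ?r j powr p) * indicator (cball a (2 * ?r j)) x"
  have r: "0 < ?r j" for j using q s by simp
  have A: "0 < A" "V > 0" by (auto simp: A_def V_def)
  have shell: "t powr p \<le> A * \<rho> powr p" if "0 < \<rho>" "\<rho> \<le> t" "t \<le> 2 * \<rho>" for t \<rho>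
  proof (cases "0 \<le> p")
    case True
    have "t powr p \<le> (2 * \<rho>) powr p" using that True by (intro powr_mono2) auto
    also have "\<dots> = 2 powr p * \<rho> powr p" using that by (simp add: powr_mult)
    also have "\<dots> \<le> A * \<rho> powr p" by (intro mult_right_mono) (auto simp: A_def)
    finally show ?thesis .
  next
    case False
    have "t powr p \<le> 1 * \<rho> powr p" using that False by (simp add: powr_mono2')
    also have "\<dots> \<le> A * \<rho> powr p" by (intro mult_right_mono) (auto simp: A_def)
    finally show ?thesis .
  qed
  have pointwise: "ennreal (indicator S x * norm (x - a) powr p) \<le> (\<Sum>j. ?h j x)" for x
  proof (cases "x \<in> S \<and> x \<noteq> a")
    case True
    then obtain j where j: "?r j \<le> norm (x - a)" "norm (x - a) \<le> 2 * ?r j" using cover by blast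
    have "ennreal (indicator S x * norm (x - a) powr p) \<le> ?h j x"
      using True j shell[OF r j] by (auto simp: dist_norm norm_minus_commute indicator_def intro!: ennreal_leI)
    also have "\<dots> \<le> (\<Sum>j. ?h j x)"
      using sum_le_suminf[of "\<lambda>j. ?h j x" "{j}"] by (simp del: sum_mult_indicator)
    finally show ?thesis .
  \<comment> \<open>At \<open>x = a\<close> the left side is zero even for negative
    \<open>p\<close>, since \<open>0 powr p = 0\<close>.\<close>
  qed (auto simp: indicator_def)
  define B where "B = A * s powr p * V * (2 * s) ^ DIM('a)"
  have B: "B > 0" using A s by (simp add: B_def)
  have shell_integral: "(\<integral>\<^sup>+x. ?h j x \<partial>lborel) = ennreal (B * (q powr (p + DIM('a))) ^ j)" for j
  proof -
    have "(\<integral>\<^sup>+x. ?h j x \<partial>lborel) = ennreal (A * ?r j powr p) * emeasure lborel (cball a (2 * ?r j))"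
      by (subst nn_integral_cmult_indicator) auto
    also have "emeasure lborel (cball a (2 * ?r j)) = ennreal (V * (2 * ?r j) ^ DIM('a))"
      using r[of j] by (subst emeasure_cball) (auto simp: V_def)
    also have "ennreal (A * ?r j powr p) * \<dots> = ennreal (A * ?r j powr p * (V * (2 * ?r j) ^ DIM('a)))"
      using A r[of j] by (subst ennreal_mult) auto
    also have "A * ?r j powr p * (V * (2 * ?r j) ^ DIM('a)) = B * ((q ^ j) powr p * (q ^ j) ^ DIM('a))"
      using q s by (simp add: B_def powr_mult power_mult_distrib)
    also have "(q ^ j) powr p * (q ^ j) ^ DIM('a) = (q ^ j) powr (p + DIM('a))"
      using q by (simp add: powr_add powr_realpow)
    also have "\<dots> = (q powr (p + DIM('a))) ^ j"
      using q by (simp add: powr_realpow[symmetric] powr_powr mult.commute)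
    finally show ?thesis .
  qed
  have h_measurable: "?h j \<in> borel_measurable lborel" for j
    by (intro borel_measurable_times_ennreal borel_measurable_const borel_measurable_indicator) simp
  have "(\<integral>\<^sup>+x. ennreal (indicator S x * norm (x - a) powr p) \<partial>lborel) \<le> (\<integral>\<^sup>+x. (\<Sum>j. ?h j x) \<partial>lborel)"
    by (rule nn_integral_mono) (rule pointwise)
  also have "\<dots> = (\<Sum>j. \<integral>\<^sup>+x. ?h j x \<partial>lborel)"
    by (rule nn_integral_suminf) (rule h_measurable)
  also have "\<dots> = (\<Sum>j. ennreal (B * (q powr (p + DIM('a))) ^ j))"
    by (rule suminf_cong) (rule shell_integral)
  also have "\<dots> < \<infinity>"
  proof -
    have "summable (\<lambda>j. B * (q powr (p + DIM('a))) ^ j)"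
      using q by (intro summable_mult summable_geometric) auto
    thus ?thesis using B by (subst suminf_ennreal2) auto
  qed
  finally have fin: "(\<integral>\<^sup>+x. ennreal (indicator S x * norm (x - a) powr p) \<partial>lborel) < \<infinity>" .
  have [measurable]: "S \<in> sets lborel" using S by simp
  have m: "(\<lambda>x. indicator S x * norm (x - a) powr p) \<in> borel_measurable lborel" by measurable
  have "integrable lborel (\<lambda>x. indicator S x * norm (x - a) powr p)"
    using m _ fin by (rule integrableI_nonneg) simp
  thus ?thesis unfolding set_integrable_def real_scaleR_def integrable_completion[OF m] .
qed

text \<open>The radii s/2, s/4, ... give shells exhausting the ball apart from its centre, and p >
  -n makes the ratio of the geometric series less than 1.\<close>

lemma set_integrable_norm_powr_cball:
  fixes a :: "'a::euclidean_space" and p s :: real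
  assumes "- DIM('a) < p" and s: "0 < s"
  shows "set_integrable lebesgue (cball a s) (\<lambda>x. norm (x - a) powr p)"
proof (rule set_integrable_norm_powr_shells[where q = "1 / 2" and s = "s / 2"])
  have "(1 / 2) powr (p + DIM('a)) = 1 / 2 powr (p + DIM('a))" by (simp add: powr_divide)
  also have "\<dots> < 1" using assms by simp
  finally show "(1 / 2) powr (p + DIM('a)) < 1" .
  fix x assume x: "x \<in> cball a s" "x \<noteq> a"
  hence n: "norm (x - a) > 0" "norm (x - a) \<le> s" by (auto simp: dist_norm norm_minus_commute)
  then obtain j where j: "2 ^ j \<le> s / norm (x - a)" "s / norm (x - a) \<le> 2 * 2 ^ j"
    using power_of_two_bracket[of "s / norm (x - a)"] by auto
  show "\<exists>j. s / 2 * (1 / 2) ^ j \<le> norm (x - a) \<and> norm (x - a) \<le> 2 * (s / 2 * (1 / 2) ^ j)"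
    using j n by (intro exI[of _ j]) (auto simp: field_simps power_divide)
qed (use s in auto)

text \<open>Here the shells double outwards from radius \<open>s\<close>, and convergence needs p +
  n < 0.\<close>

lemma set_integrable_norm_powr_compl_ball:
  fixes a :: "'a::euclidean_space" and p s :: real
  assumes "p < - DIM('a)" and s: "0 < s"
  shows "set_integrable lebesgue (- ball a s) (\<lambda>x. norm (x - a) powr p)"
proof (rule set_integrable_norm_powr_shells[where q = 2 and s = s])
  have "2 powr (p + DIM('a)) < 2 powr (0::real)" using assms by (intro powr_less_mono) auto
  thus "(2::real) powr (p + DIM('a)) < 1" by simp
  fix x assume x: "x \<in> - ball a s" "x \<noteq> a"
  hence n: "norm (x - a) \<ge> s" by (auto simp: dist_norm norm_minus_commute)
  then obtain j where j: "2 ^ j \<le> norm (x - a) / s" "norm (x - a) / s \<le> 2 * 2 ^ j"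
    using s power_of_two_bracket[of "norm (x - a) / s"] by auto
  show "\<exists>j. s * 2 ^ j \<le> norm (x - a) \<and> norm (x - a) \<le> 2 * (s * 2 ^ j)"
    using j s by (intro exI[of _ j]) (auto simp: field_simps)
qed (use s in auto)

section \<open>The principal value as an absolutely convergent integral\<close>

text \<open>The gradient vanishes at the interior minimum \<open>a\<close>, so its Lipschitz bound
  makes it at most K times the distance to \<open>a\<close>; the mean value inequality supplies the
  second factor of the distance.\<close>

lemma quadratic_bound_at_minimum:
  fixes u :: "'a::euclidean_space \<Rightarrow> real"
  assumes deriv: "\<And>x. x \<in> ball a r \<Longrightarrow> GDERIV u x :> g x" and r: "0 < r"
    and lip: "K-lipschitz_on (ball a r) g" and min: "\<And>y. y \<in> ball a r \<Longrightarrow> u a \<le> u y"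
    and y: "y \<in> ball a r"
  shows "\<bar>u a - u y\<bar> \<le> K * norm (y - a) ^ 2"
proof -
  have "(\<lambda>h. h \<bullet> g a) = (\<lambda>h. 0)"
  proof (rule differential_zero_maxmin[where S = "ball a r"])
    show "(u has_derivative (\<lambda>h. h \<bullet> g a)) (at a)"
      using deriv[of a] r by (simp add: gderiv_def)
  qed (use r min in auto)
  hence ga: "g a = 0" by (metis inner_eq_zero_iff)
  have K: "K \<ge> 0" using lip by (rule lipschitz_on_nonneg)
  \<comment> \<open>A convex set containing \<open>a\<close> and \<open>y\<close> on which the
    gradient is at most \<open>K * norm (y - a)\<close>.\<close>
  let ?B = "cball a (norm (y - a))"
  have sub: "?B \<subseteq> ball a r" using y by (auto simp: dist_norm norm_minus_commute)
  have "norm (u y - u a) \<le> (K * norm (y - a)) * norm (y - a)"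
  proof (rule differentiable_bound[where f' = "\<lambda>x h. h \<bullet> g x" and S = ?B])
    fix x assume x: "x \<in> ?B"
    show "(u has_derivative (\<lambda>h. h \<bullet> g x)) (at x within ?B)"
      using deriv[OF subsetD[OF sub x]] unfolding gderiv_def by (rule has_derivative_at_withinI)
    have "norm (g x) \<le> K * norm (x - a)"
      using lipschitz_onD[OF lip, of x a] x sub r ga by (auto simp: dist_norm)
    also have "\<dots> \<le> K * norm (y - a)"
      using x K by (intro mult_left_mono) (auto simp: dist_norm norm_minus_commute)
    finally have gx: "norm (g x) \<le> K * norm (y - a)" .
    show "onorm (\<lambda>h. h \<bullet> g x) \<le> K * norm (y - a)"
    proof (rule onorm_le)
      fix h
      have "norm (h \<bullet> g x) \<le> norm h * norm (g x)" by (simp add: Cauchy_Schwarz_ineq2)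
      also have "\<dots> \<le> norm h * (K * norm (y - a))" using gx by (intro mult_left_mono) auto
      finally show "norm (h \<bullet> g x) \<le> K * norm (y - a) * norm h" by (simp add: mult.commute)
    qed
  qed (auto simp: dist_norm norm_minus_commute)
  thus ?thesis by (simp add: power2_eq_square abs_minus_commute)
qed

lemma measurable_norm_diff_powr [measurable]:
  "(\<lambda>z::'a::euclidean_space. norm (z - a) powr p) \<in> borel_measurable lebesgue"
  by (rule measurable_completion) simp

text \<open>Inside the ball the quadratic bound leaves the exponent 2 - p, which exceeds -n because
  \<alpha> < 2. Outside, the part with \<open>u a\<close> decays with exponent p > n because
  \<alpha> > 0, and the part with \<open>u z\<close> is controlled by the weight in
  \<open>L_space\<close>.\<close>

lemma integrable_difference_quotient:
  fixes u :: "real ^ 'n::finite \<Rightarrow> real"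
  assumes \<alpha>: "0 < \<alpha>" "\<alpha> < 2" and u: "u \<in> L_space \<alpha>" and s: "0 < s"
    and quad: "\<And>y. y \<in> cball a s \<Longrightarrow> \<bar>u a - u y\<bar> \<le> K * norm (y - a) ^ 2"
  shows "integrable lebesgue (\<lambda>z. (u a - u z) / norm (a - z) powr (real CARD('n) + \<alpha>))"
    (is "integrable _ ?g")
proof -
  define p where "p = real CARD('n) + \<alpha>"
  have p: "p > 0" using \<alpha> by (simp add: p_def add_nonneg_pos)
  have um [measurable]: "u \<in> borel_measurable lebesgue"
    and ufin: "(\<integral>\<^sup>+ x. ennreal (\<bar>u x\<bar> / (1 + norm x powr p)) \<partial>lebesgue) < \<infinity>"
    using u by (auto simp: L_space_def p_def)
  have nm [measurable]: "(\<lambda>z::real^'n. norm z powr p) \<in> borel_measurable lebesgue"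
    using measurable_norm_diff_powr[of 0 p] by simp
  have int_u: "integrable lebesgue (\<lambda>x. \<bar>u x\<bar> / (1 + norm x powr p))"
    using ufin by (intro integrableI_nonneg) auto
  have near: "set_integrable lebesgue (cball a s) (\<lambda>x. norm (x - a) powr (2 - p))"
    using \<alpha> s by (intro set_integrable_norm_powr_cball) (auto simp: p_def)
  have far: "set_integrable lebesgue (- ball a s) (\<lambda>x. norm (x - a) powr (- p))"
    using \<alpha> s by (intro set_integrable_norm_powr_compl_ball) (auto simp: p_def)
  \<comment> \<open>Chosen so that \<open>1 + norm z powr p \<le> M * norm (z - a) powr p\<close>
    outside the ball: the first summand absorbs the 1, the second absorbs
    \<open>norm z powr p\<close>.\<close>
  define M where "M = s powr (- p) + (1 + norm a / s) powr p"
  have M: "M \<ge> 0" by (simp add: M_def)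
  let ?n = "\<lambda>z. \<bar>K\<bar> * (indicator (cball a s) z * norm (z - a) powr (2 - p))"
  let ?f = "\<lambda>z. \<bar>u a\<bar> * (indicator (- ball a s) z * norm (z - a) powr (- p)) + M * (\<bar>u z\<bar> / (1 + norm z powr p))"
  have int: "integrable lebesgue (\<lambda>z. ?n z + ?f z)"
    using near far int_u unfolding set_integrable_def
    by (intro Bochner_Integration.integrable_add integrable_mult_right) simp_all
  have n0: "0 \<le> ?n z" and f0: "0 \<le> ?f z" for z
    using M by (auto intro!: add_nonneg_nonneg mult_nonneg_nonneg divide_nonneg_nonneg)
  have bound: "norm (?g z) \<le> ?n z + ?f z" for z
  proof (cases "z \<in> cball a s")
    case True
    have "norm (?g z) \<le> ?n z"
    proof (cases "z = a")
      case False
      hence nz: "norm (z - a) > 0" by simp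
      have "norm (?g z) = \<bar>u a - u z\<bar> / norm (z - a) powr p"
        by (simp add: p_def norm_minus_commute)
      also have "\<dots> \<le> (\<bar>K\<bar> * norm (z - a) ^ 2) / norm (z - a) powr p"
        by (intro divide_right_mono order.trans[OF quad[OF True]] mult_right_mono) auto
      also have "\<dots> = \<bar>K\<bar> * norm (z - a) powr (2 - p)"
        using nz by (simp add: powr_diff)
      finally show ?thesis using True by simp
    qed simp
    with f0[of z] show ?thesis by linarith
  next
    case False
    hence nz: "norm (z - a) \<ge> s" "norm (z - a) > 0" using s
      by (auto simp: dist_norm norm_minus_commute)
    \<comment> \<open>The factor 1 is written out so that it can be replaced by
      \<open>norm (z - a) / s\<close>, which is at least 1 here.\<close>
    have "norm z \<le> norm (z - a) + norm a * 1" using norm_triangle_ineq[of "z - a" a] by simp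
    also have "\<dots> \<le> norm (z - a) + norm a * (norm (z - a) / s)"
      using nz s by (intro add_left_mono mult_left_mono) auto
    also have "\<dots> = norm (z - a) * (1 + norm a / s)" by (simp add: algebra_simps)
    finally have "norm z powr p \<le> (norm (z - a) * (1 + norm a / s)) powr p"
      using p by (intro powr_mono2) auto
    also have "\<dots> = norm (z - a) powr p * (1 + norm a / s) powr p"
      using s by (simp add: powr_mult)
    finally have 1: "norm z powr p \<le> norm (z - a) powr p * (1 + norm a / s) powr p" .
    have "s powr p \<le> norm (z - a) powr p" using nz p s by (intro powr_mono2) auto
    hence "1 \<le> norm (z - a) powr p * s powr (- p)"
      using s by (simp add: powr_minus field_simps)
    with 1 have "1 + norm z powr p \<le> M * norm (z - a) powr p"
      by (simp add: M_def algebra_simps)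
    moreover have "1 + norm z powr p > 0" by (simp add: add_pos_nonneg)
    ultimately have 2: "1 / norm (z - a) powr p \<le> M / (1 + norm z powr p)"
      using nz by (simp add: field_simps)
    have "norm (?g z) = \<bar>u a - u z\<bar> / norm (z - a) powr p"
      by (simp add: p_def norm_minus_commute)
    also have "\<dots> \<le> (\<bar>u a\<bar> + \<bar>u z\<bar>) / norm (z - a) powr p"
      by (intro divide_right_mono) auto
    also have "\<dots> = \<bar>u a\<bar> * norm (z - a) powr (- p) + \<bar>u z\<bar> * (1 / norm (z - a) powr p)"
      by (simp add: powr_minus divide_inverse distrib_right)
    also have "\<dots> \<le> \<bar>u a\<bar> * norm (z - a) powr (- p) + \<bar>u z\<bar> * (M / (1 + norm z powr p))"
      using 2 by (intro add_left_mono mult_left_mono) auto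
    also have "\<dots> = ?f z" using False nz by (simp add: dist_norm norm_minus_commute)
    finally show ?thesis using n0[of z] by linarith
  qed
  have gm: "?g \<in> borel_measurable lebesgue"
    unfolding p_def[symmetric] norm_minus_commute[of a] by measurable
  show ?thesis
    using int gm by (rule Bochner_Integration.integrable_bound) (use bound n0 f0 in \<open>auto intro!: AE_I2 intro: order.trans[OF bound]\<close>)
qed

text \<open>Once the quotient is integrable it dominates its own truncations, which converge to it
  pointwise.\<close>

lemma frac_laplacian_eq_integral:
  fixes u :: "real ^ 'n::finite \<Rightarrow> real"
  assumes int: "integrable lebesgue (\<lambda>z. (u x - u z) / norm (x - z) powr (real CARD('n) + \<alpha>))"
  shows "frac_laplacian C \<alpha> u x =
    C * (LINT z|lebesgue. (u x - u z) / norm (x - z) powr (real CARD('n) + \<alpha>))"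
proof -
  let ?g = "\<lambda>z. (u x - u z) / norm (x - z) powr (real CARD('n) + \<alpha>)"
  have "((\<lambda>\<epsilon>. LINT z : (UNIV - ball x \<epsilon>) | lebesgue. ?g z) \<longlongrightarrow> (LINT z|lebesgue. ?g z)) (at_right 0)"
  \<comment> \<open>Dominated convergence concerns sequences, so the one-sided limit is tested along
    positive sequences tending to 0.\<close>
  proof (rule tendsto_at_right_sequentially[of 0 1])
    fix S :: "nat \<Rightarrow> real"
    assume S: "\<And>n. 0 < S n" "S \<longlonglongrightarrow> 0"
    show "(\<lambda>n. LINT z : (UNIV - ball x (S n)) | lebesgue. ?g z) \<longlonglongrightarrow> (LINT z|lebesgue. ?g z)"
      unfolding set_lebesgue_integral_def
    proof (rule integral_dominated_convergence[where w = "\<lambda>z. norm (?g z)"])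
      show "integrable lebesgue (\<lambda>z. norm (?g z))" using int by (rule integrable_norm)
      show gm: "?g \<in> borel_measurable lebesgue" using int by (rule borel_measurable_integrable)
      show "(\<lambda>z. indicat_real (UNIV - ball x (S n)) z *\<^sub>R ?g z) \<in> borel_measurable lebesgue" for n
        using gm by (intro borel_measurable_scaleR borel_measurable_indicator) auto
      show "AE z in lebesgue. norm (indicat_real (UNIV - ball x (S n)) z *\<^sub>R ?g z) \<le> norm (?g z)" for n
        by (auto simp: indicator_def)
      have "(\<lambda>n. indicat_real (UNIV - ball x (S n)) z *\<^sub>R ?g z) \<longlonglongrightarrow> ?g z" for z
      proof (cases "z = x")
        case False
        hence "eventually (\<lambda>n. S n < dist x z) sequentially"
          using order_tendstoD(2)[OF S(2)] by simp
        hence "eventually (\<lambda>n. indicat_real (UNIV - ball x (S n)) z *\<^sub>R ?g z = ?g z) sequentially"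
          by eventually_elim (auto simp: indicator_def)
        thus ?thesis by (rule tendsto_eventually)
      qed simp
      thus "AE z in lebesgue. (\<lambda>n. indicat_real (UNIV - ball x (S n)) z *\<^sub>R ?g z) \<longlonglongrightarrow> ?g z"
        by simp
    qed
  qed simp
  thus ?thesis unfolding frac_laplacian_def by (simp add: tendsto_Lim)
qed

section \<open>The reflection: invariance of the measure and comparison of distances\<close>

text \<open>In coordinates the reflection is a diagonal affine map with entries 1 and -1, so the
  factor in the change of variables, the product of their absolute values, is 1.\<close>

lemma
  fixes k :: "'n::finite"
  shows measurable_reflect: "reflect k l \<in> lebesgue \<rightarrow>\<^sub>M lebesgue"
    and distr_lebesgue_reflect: "distr lebesgue lebesgue (reflect k l) = lebesgue"
proof -
  define c :: "real ^ 'n \<Rightarrow> real" where "c j = (if j = axis k 1 then - 1 else 1)" for j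
  have c: "c j \<noteq> 0" for j by (simp add: c_def)
  have eq: "reflect k l = (\<lambda>x. (2 * l) *\<^sub>R axis k 1 + (\<Sum>j\<in>Basis. (c j * (x \<bullet> j)) *\<^sub>R j))"
    (is "_ = ?T")
  proof
    fix x
    have "reflect k l x $ i = ?T x $ i" for i
    proof -
      have axis_nth: "axis k (1::real) $ i = (if i = k then 1 else 0)" by (simp add: axis_def)
      have "?T x $ i = ?T x \<bullet> axis i 1" by (rule cart_eq_inner_axis)
      also have "\<dots> = 2 * l * (axis k (1::real) \<bullet> axis i 1) + c (axis i 1) * (x \<bullet> axis i 1)"
        by (simp add: inner_add_left inner_sum_left_Basis axis_in_Basis_iff)
      also have "\<dots> = reflect k l x $ i"
        by (simp add: c_def reflect_def axis_eq_axis inner_axis axis_nth)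
      finally show ?thesis ..
    qed
    thus "reflect k l x = ?T x" by (simp add: vec_eq_iff)
  qed
  show "reflect k l \<in> lebesgue \<rightarrow>\<^sub>M lebesgue"
    unfolding eq by (rule lebesgue_affine_measurable) (rule c)
  have "(\<Prod>j\<in>Basis. \<bar>c j\<bar>) = 1" by (rule prod.neutral) (simp add: c_def)
  thus "distr lebesgue lebesgue (reflect k l) = lebesgue"
    using lebesgue_affine_euclidean[of c "(2 * l) *\<^sub>R axis k 1"] c
    by (simp add: eq density_1)
qed

lemma reflect_reflect: "reflect k l (reflect k l x) = x"
  by (simp add: reflect_def vec_eq_iff)

text \<open>Only the coordinate \<open>k\<close> changes, and there the difference of l - x_k and l
  - y_k, both positive, is replaced by their sum.\<close>

lemma norm_diff_le_norm_diff_reflect: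
  assumes "x \<in> halfspace k l" "y \<in> halfspace k l"
  shows "norm (x - y) \<le> norm (x - reflect k l y)"
  unfolding norm_vec_def
proof (rule L2_set_mono)
  fix i show "norm ((x - y) $ i) \<le> norm ((x - reflect k l y) $ i)"
    using assms by (auto simp: halfspace_def reflect_def)
qed simp

lemma norm_diff_reflect_self: "norm (y - reflect k l y) = 2 * \<bar>l - y $ k\<bar>"
proof -
  have "y - reflect k l y = (2 * (y $ k - l)) *\<^sub>R axis k 1"
    by (auto simp: vec_eq_iff reflect_def axis_def)
  thus ?thesis by (simp add: norm_axis_1 abs_if)
qed

section \<open>Upper bound at a negative minimum of an antisymmetric function\<close>

text \<open>Twice the integral of the quotient \<open>g\<close> is the integral of
  \<open>g y + g (?R y)\<close>. This sum is nonpositive almost everywhere and uniformly negative on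
  a ball whose size is comparable to \<open>norm x + \<bar>l\<bar>\<close>, which gives the decay of
  order -\<alpha>.\<close>

lemma frac_laplacian_antisymmetric_le:
  fixes w :: "real ^ 'n::finite \<Rightarrow> real" and k :: 'n
  assumes C: "0 < C" and \<alpha>: "0 < \<alpha>"
    and int: "integrable lebesgue (\<lambda>z. (w x - w z) / norm (x - z) powr (real CARD('n) + \<alpha>))"
    and anti: "\<And>y. y \<in> halfspace k l \<Longrightarrow> w (reflect k l y) = - w y"
    and x: "x \<in> halfspace k l" and min: "\<And>y. y \<in> halfspace k l \<Longrightarrow> w x \<le> w y"
    and neg: "w x < 0"
  shows "frac_laplacian C \<alpha> w x \<le> C * w x * (unit_ball_vol (real CARD('n)) *
    (norm x + \<bar>l\<bar>) ^ CARD('n) / (8 * (norm x + \<bar>l\<bar>)) powr (real CARD('n) + \<alpha>))"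
proof -
  let ?R = "reflect k l"
  define p where "p = real CARD('n) + \<alpha>"
  define r where "r = norm x + \<bar>l\<bar>"
  define g where "g z = (w x - w z) / norm (x - z) powr p" for z
  \<comment> \<open>The centre is shifted by exactly the radius away from the hyperplane, so every
    point of \<open>B\<close> has a smaller \<open>k\<close>-coordinate than \<open>x\<close>. Hence
    \<open>B\<close> fits into the half-space however close \<open>x\<close> is to its
    boundary.\<close>
  define B where "B = ball (x - r *\<^sub>R axis k 1) r"
  define b where "b = 2 * w x / (8 * r) powr p"
  have p: "p > 0" using \<alpha> by (simp add: p_def add_nonneg_pos)
  have xk: "x $ k < l" using x by (simp add: halfspace_def)
  have "r \<noteq> 0"
  proof
    assume "r = 0"
    hence "x = 0 \<and> l = 0" by (simp add: r_def add_nonneg_eq_0_iff)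
    with xk show False by simp
  qed
  hence r: "r > 0" by (simp add: r_def add_nonneg_nonneg less_le)
  have gint: "integrable lebesgue g" using int by (simp add: g_def[abs_def] p_def)
  hence gm: "g \<in> borel_measurable lebesgue" by (rule borel_measurable_integrable)
  have gRint: "integrable lebesgue (\<lambda>z. g (?R z))"
    using integrable_distr_eq[OF measurable_reflect[of k l] gm] gint distr_lebesgue_reflect[of k l] by simp
  have gR: "(LINT z|lebesgue. g (?R z)) = (LINT z|lebesgue. g z)"
    using integral_distr[OF measurable_reflect[of k l] gm] distr_lebesgue_reflect[of k l] by simp
  have b: "b \<le> 0" using neg by (simp add: b_def divide_nonpos_nonneg)
  have pair: "g y + g (?R y) \<le> 2 * w x / norm (x - ?R y) powr p" if y: "y \<in> halfspace k l" for y
  proof -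
    have pos: "0 < norm (x - ?R y)"
      using xk y by (auto simp: halfspace_def reflect_def vec_eq_iff)
    \<comment> \<open>The numerator is nonpositive by minimality, so the larger mirror distance
      raises the quotient. With equal denominators, \<open>w y\<close> then cancels against the
      antisymmetric term.\<close>
    have "g y \<le> (w x - w y) / norm (x - ?R y) powr p"
    proof (cases "x = y")
      case False
      have "norm (x - y) powr p \<le> norm (x - ?R y) powr p"
        using norm_diff_le_norm_diff_reflect[OF x y] p by (intro powr_mono2) auto
      thus ?thesis unfolding g_def using min[OF y] False pos
        by (intro divide_left_mono_neg) auto
    qed (simp add: g_def)
    moreover have "g (?R y) = (w x + w y) / norm (x - ?R y) powr p"
      by (simp add: g_def anti[OF y])
    ultimately have "g y + g (?R y) \<le> (w x - w y) / norm (x - ?R y) powr p + (w x + w y) / norm (x - ?R y) powr p"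
      by simp
    also have "\<dots> = 2 * w x / norm (x - ?R y) powr p" by (simp add: add_divide_distrib[symmetric])
    finally show ?thesis .
  qed
  have nonpos: "g y + g (?R y) \<le> 0" if "y \<in> halfspace k l" for y
    using pair[OF that] by (rule order.trans) (use neg in \<open>simp add: divide_nonpos_nonneg\<close>)
  have B_sub: "B \<subseteq> halfspace k l"
  proof
    fix y assume "y \<in> B"
    hence "norm (y - (x - r *\<^sub>R axis k 1)) < r" by (simp add: B_def dist_norm norm_minus_commute)
    hence "\<bar>(y - (x - r *\<^sub>R axis k 1)) $ k\<bar> < r" using component_le_norm_cart order.strict_trans1 by blast
    thus "y \<in> halfspace k l" using xk by (simp add: halfspace_def)
  qed
  have on_B: "g y + g (?R y) \<le> b" if y: "y \<in> B" for y
  \<comment> \<open>The factor 8 is 2 + 6: \<open>y\<close> lies within 2r of \<open>x\<close>,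
    hence within 3r of the hyperplane, hence within 6r of its mirror image.\<close>
  proof -
    have yS: "y \<in> halfspace k l" using y B_sub by auto
    have "norm (y - (x - r *\<^sub>R axis k 1)) < r" using y by (simp add: B_def dist_norm norm_minus_commute)
    moreover have "norm (y - x) \<le> norm (y - (x - r *\<^sub>R axis k 1)) + norm (r *\<^sub>R axis k (1::real))"
      using norm_triangle_ineq4[of "y - (x - r *\<^sub>R axis k 1)" "r *\<^sub>R axis k 1"] by simp
    ultimately have yx: "norm (x - y) \<le> 2 * r" using r by (simp add: norm_axis_1 norm_minus_commute)
    have "norm y \<le> norm x + norm (x - y)" using norm_triangle_ineq4[of x "x - y"] by simp
    hence "\<bar>l - y $ k\<bar> \<le> 3 * r" using yx component_le_norm_cart[of y k] by (simp add: r_def)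
    hence "norm (y - ?R y) \<le> 6 * r" by (simp add: norm_diff_reflect_self)
    moreover have "norm (x - ?R y) \<le> norm (x - y) + norm (y - ?R y)"
      using norm_triangle_ineq[of "x - y" "y - ?R y"] by simp
    ultimately have "norm (x - ?R y) \<le> 8 * r" using yx by linarith
    hence "norm (x - ?R y) powr p \<le> (8 * r) powr p" using p by (intro powr_mono2) auto
    moreover have "0 < norm (x - ?R y)"
      using xk yS by (auto simp: halfspace_def reflect_def vec_eq_iff)
    ultimately have "2 * w x / norm (x - ?R y) powr p \<le> b"
      unfolding b_def using neg r by (intro divide_left_mono_neg) auto
    with pair[OF yS] show ?thesis by linarith
  qed
  \<comment> \<open>The paired sum is invariant under the reflection, so the bounds from the
    half-space carry over to the other side; only the hyperplane, a null set, is left out.\<close>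
  have ae: "AE y in lebesgue. g y + g (?R y) \<le> b * indicator B y"
  proof (rule AE_I')
    have "negligible {y::real^'n. y \<bullet> axis k 1 = l}"
      by (rule negligible_standard_hyperplane) (simp add: axis_in_Basis_iff)
    thus "{y::real^'n. y $ k = l} \<in> null_sets lebesgue"
      by (simp add: negligible_iff_null_sets cart_eq_inner_axis)
    show "{y \<in> space lebesgue. \<not> g y + g (?R y) \<le> b * indicator B y} \<subseteq> {y. y $ k = l}"
    proof (rule subsetI, rule ccontr)
      fix y assume *: "y \<in> {y \<in> space lebesgue. \<not> g y + g (?R y) \<le> b * indicator B y}"
        "y \<notin> {y. y $ k = l}"
      then consider "y \<in> B" | "y \<notin> B" "y \<in> halfspace k l" | "y \<notin> B" "?R y \<in> halfspace k l"
        by (force simp: halfspace_def reflect_def)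
      thus False
      proof cases
        case 3
        from nonpos[OF 3(2)] * 3 show False by (simp add: reflect_reflect)
      qed (use on_B nonpos * in auto)
    qed
  qed
  have B_fin: "emeasure lebesgue B < \<infinity>" unfolding B_def
    using lmeasurable_ball unfolding fmeasurable_def by blast
  have intB: "integrable lebesgue (indicat_real B)"
    using B_fin by (intro integrable_real_indicator) (auto simp: B_def)
  have vol: "measure lebesgue B = unit_ball_vol (real CARD('n)) * r ^ CARD('n)"
    unfolding B_def using r by (simp add: content_ball)
  have "2 * (LINT z|lebesgue. g z) = (LINT z|lebesgue. g z + g (?R z))"
    using gint gRint gR by simp
  also have "\<dots> \<le> (LINT z|lebesgue. b * indicat_real B z)"
    using ae gint gRint intB by (intro integral_mono_AE) auto
  also have "\<dots> = b * measure lebesgue B"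
    by simp
  finally have "(LINT z|lebesgue. g z) \<le> w x / (8 * r) powr p * measure lebesgue B"
    by (simp add: b_def)
  hence "C * (LINT z|lebesgue. g z) \<le> C * (w x / (8 * r) powr p * measure lebesgue B)"
    using C by (intro mult_left_mono) auto
  also have "\<dots> = C * w x * (unit_ball_vol (real CARD('n)) * r ^ CARD('n) / (8 * r) powr p)"
    by (simp add: vol)
  finally show ?thesis
    unfolding frac_laplacian_eq_integral[OF int] by (simp add: g_def p_def r_def)
qed

section \<open>The contradiction far out\<close>

theorem theorem3:
  fixes k :: "'n::finite" and C \<alpha> l :: real
    and \<Omega> :: "(real ^ 'n) set" and c :: "real ^ 'n \<Rightarrow> real"
  assumes "0 < C" and "0 < \<alpha>" and "\<alpha> < 2"
    and "open \<Omega>" and "\<not> bounded \<Omega>" and "\<Omega> \<subseteq> halfspace k l"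
    and "0 \<le> Liminf (inf at_infinity (principal \<Omega>)) (\<lambda>x. ereal (norm x powr \<alpha> * c x))"
  shows "\<exists>R\<^sub>0>0. \<forall>w x\<^sub>0.
    w \<in> L_space \<alpha> \<inter> C11_loc \<Omega> \<longrightarrow>
    (\<forall>x\<in>\<Omega>. 0 \<le> frac_laplacian C \<alpha> w x + c x * w x) \<longrightarrow>
    (\<forall>x\<in>halfspace k l - \<Omega>. 0 \<le> w x) \<longrightarrow>
    (\<forall>x\<in>halfspace k l. w (reflect k l x) = - w x) \<longrightarrow>
    x\<^sub>0 \<in> \<Omega> \<longrightarrow> (\<forall>x\<in>\<Omega>. w x\<^sub>0 \<le> w x) \<longrightarrow> w x\<^sub>0 < 0 \<longrightarrow>
    norm x\<^sub>0 \<le> R\<^sub>0"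
proof -
  define p where "p = real CARD('n) + \<alpha>"
  define V where "V = unit_ball_vol (real CARD('n))"
  \<comment> \<open>The constant of the upper bound, with \<open>2 powr \<alpha>\<close> for passing
    from \<open>norm x + \<bar>l\<bar>\<close> to \<open>norm x\<close>. It does not involve
    \<open>w\<close>, and neither does the radius \<open>R\<close> obtained from it.\<close>
  define \<delta> where "\<delta> = C * V / (8 powr p * 2 powr \<alpha>)"
  have V: "V > 0" by (simp add: V_def)
  have \<delta>: "\<delta> > 0" using V \<open>0 < C\<close> by (simp add: \<delta>_def)
  have "eventually (\<lambda>x. ereal (- \<delta>) < ereal (norm x powr \<alpha> * c x)) (inf at_infinity (principal \<Omega>))"
    using assms(7) \<delta> unfolding le_Liminf_iff by (elim allE[of _ "ereal (- \<delta>)"]) simp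
  then obtain R where R: "\<And>x. R \<le> norm x \<Longrightarrow> x \<in> \<Omega> \<Longrightarrow> - \<delta> < norm x powr \<alpha> * c x"
    unfolding eventually_inf_principal eventually_at_infinity by auto
  show ?thesis
  \<comment> \<open>The three entries ensure positivity, the lower bound on \<open>c\<close> from
    the limit inferior, and \<open>norm x + \<bar>l\<bar> \<le> 2 * norm x\<close>.\<close>
  proof (intro exI[of _ "max 1 (max R \<bar>l\<bar>)"] conjI allI impI)
    show "0 < max 1 (max R \<bar>l\<bar>)" by simp
    fix w x
    assume w: "w \<in> L_space \<alpha> \<inter> C11_loc \<Omega>"
      and ineq: "\<forall>x\<in>\<Omega>. 0 \<le> frac_laplacian C \<alpha> w x + c x * w x"
      and nonneg: "\<forall>x\<in>halfspace k l - \<Omega>. 0 \<le> w x"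
      and anti: "\<forall>x\<in>halfspace k l. w (reflect k l x) = - w x"
      and x: "x \<in> \<Omega>" and min: "\<forall>y\<in>\<Omega>. w x \<le> w y" and neg: "w x < 0"
    show "norm x \<le> max 1 (max R \<bar>l\<bar>)"
    proof (rule ccontr)
      assume "\<not> norm x \<le> max 1 (max R \<bar>l\<bar>)"
      hence far: "1 < norm x" "R \<le> norm x" "\<bar>l\<bar> \<le> norm x" by auto
      obtain g r K where deriv: "\<And>y. y \<in> \<Omega> \<Longrightarrow> GDERIV w y :> g y"
        and r: "r > 0" and lip: "K-lipschitz_on (ball x r \<inter> \<Omega>) g"
        using w x unfolding C11_loc_def by blast
      obtain e where e: "e > 0" "ball x e \<subseteq> \<Omega>"
        using \<open>open \<Omega>\<close> x by (rule openE)
      define t where "t = min r e"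
      have t: "t > 0" "ball x t \<subseteq> ball x r \<inter> \<Omega>" using r e by (auto simp: t_def)
      have quad: "\<bar>w x - w y\<bar> \<le> K * norm (y - x) ^ 2" if "y \<in> cball x (t / 2)" for y
      proof (rule quadratic_bound_at_minimum[where r = t and g = g])
        show "K-lipschitz_on (ball x t) g" using lip t(2) by (rule lipschitz_on_subset)
        show "y \<in> ball x t" using that t(1) by auto
      qed (use t deriv min in auto)
      have int: "integrable lebesgue (\<lambda>z. (w x - w z) / norm (x - z) powr (real CARD('n) + \<alpha>))"
        using w t(1) assms(2,3) quad
        by (intro integrable_difference_quotient[where s = "t / 2" and K = K]) auto
      \<comment> \<open>Outside \<Omega> the function is nonnegative, hence above the negative value
        at \<open>x\<close>.\<close>
      have min': "w x \<le> w y" if "y \<in> halfspace k l" for y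
        using that min nonneg neg by (cases "y \<in> \<Omega>") force+
      define \<rho> where "\<rho> = norm x + \<bar>l\<bar>"
      have \<rho>: "0 < \<rho>" "\<rho> \<le> 2 * norm x" using far by (auto simp: \<rho>_def)
      have "frac_laplacian C \<alpha> w x \<le> C * w x * (V * \<rho> ^ CARD('n) / (8 * \<rho>) powr p)"
        using frac_laplacian_antisymmetric_le[OF assms(1,2) int, of k l] anti min' neg x assms(6)
        by (auto simp: \<rho>_def V_def p_def)
      \<comment> \<open>The volume factor cancels n of the n + \<alpha> powers of \<rho>.\<close>
      also have "V * \<rho> ^ CARD('n) / (8 * \<rho>) powr p = V / 8 powr p / \<rho> powr \<alpha>"
        using \<rho> by (simp add: p_def powr_mult powr_add powr_realpow)
      finally have "0 \<le> C * w x * (V / 8 powr p / \<rho> powr \<alpha>) + c x * w x"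
        using ineq x by fastforce
      also have "\<dots> = w x * (C * V / 8 powr p / \<rho> powr \<alpha> + c x)"
        by (simp add: algebra_simps)
      \<comment> \<open>Dividing by \<open>w x < 0\<close> reverses the inequality and removes
        \<open>w\<close>.\<close>
      finally have "C * V / 8 powr p / \<rho> powr \<alpha> + c x \<le> 0"
        using neg by (simp add: zero_le_mult_iff)
      hence "norm x powr \<alpha> * (C * V / 8 powr p / \<rho> powr \<alpha> + c x) \<le> 0"
        by (intro mult_nonneg_nonpos) auto
      hence 1: "norm x powr \<alpha> * c x \<le> - (C * V / 8 powr p * (norm x powr \<alpha> / \<rho> powr \<alpha>))"
        by (simp add: algebra_simps)
      have "\<rho> powr \<alpha> \<le> (2 * norm x) powr \<alpha>" using \<rho> assms(2) by (intro powr_mono2) auto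
      hence "1 / 2 powr \<alpha> \<le> norm x powr \<alpha> / \<rho> powr \<alpha>"
        using \<rho> by (simp add: powr_mult field_simps)
      hence "C * V / 8 powr p * (1 / 2 powr \<alpha>) \<le> C * V / 8 powr p * (norm x powr \<alpha> / \<rho> powr \<alpha>)"
        using V assms(1) by (intro mult_left_mono) auto
      with 1 have "norm x powr \<alpha> * c x \<le> - \<delta>" by (simp add: \<delta>_def)
      with R[OF far(2) x] show False by linarith
    qed
  qed
qed

end
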